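(* Let $r_0>0$. If $k>1$, then the function $r\mapsto 1/r^k$ belongs to $L_2(r_0,\infty;r)$ and lies in the kernel of $W_{k,k-1}$, i.e. $W_{k,k-1}[1/r^k](\lambda)=0$ for all $\lambda>0$. If $k<-1$, then the function $r\mapsto r^k$ belongs to $L_2(r_0,\infty;r)$ and lies in the kernel of $W_{k,k+1}$, i.e. $W_{k,k+1}[r^k](\lambda)=0$ for all $\lambda>0$.
   Context: $J_k,Y_k$ are the Bessel functions of the first and second kind of real order $k$. For $k\in\mathbb{R}$, $r_0>0$, $$W_{k,k\pm1}[f](\lambda)=\int_{r_0}^\infty \frac{J_k(\lambda s)Y_{k\pm1}(\lambda r_0)-Y_k(\lambda s)J_{k\pm1}(\lambda r_0)}{\sqrt{J_{k\pm1}^2(\lambda r_0)+Y_{k\pm1}^2(\lambda r_0)}}\,f(s)\,s\,ds,\qquad \lambda>0,$$ where the integral is understood as an improper integral $\lim_{R\to\infty}\int_{r_0}^R$. $L_2(r_0,\infty;r)$ is the space of functions on $(r_0,\infty)$ that are square-integrable with respect to $r\,dr$. *)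

theory Defs
  imports "HOL-Analysis.Analysis"
begin

text \<open>
  Bessel functions of real order, meant for arguments \<open>x > 0\<close> only. Using the entire function
  \<^const>\<open>rGamma\<close> (the reciprocal of Gamma, zero at the nonpositive integers) makes the series
  meaningful at every real order.
\<close>
definition bessel_J :: "real \<Rightarrow> real \<Rightarrow> real" where
  "bessel_J k x = (\<Sum>m. (-1) ^ m / fact m * rGamma (real m + k + 1) * (x / 2) powr (2 * real m + k))"

definition bessel_Y_quot :: "real \<Rightarrow> real \<Rightarrow> real" where
  "bessel_Y_quot k x = (bessel_J k x * cos (k * pi) - bessel_J (- k) x) / sin (k * pi)"

definition bessel_Y :: "real \<Rightarrow> real \<Rightarrow> real" where
  "bessel_Y k x =
     (if k \<in> \<int> then Lim (at k) (\<lambda>\<nu>. bessel_Y_quot \<nu> x) else bessel_Y_quot k x)"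

text \<open>
  The transform \<open>W\<^bsub>k,l\<^esub>\<close>, used with \<open>l = k - 1\<close> or \<open>l = k + 1\<close>. Since \<^const>\<open>Lim\<close> and the
  Lebesgue integral are total, that the improper integral exists is the separate predicate
  \<open>W_converges\<close>.
\<close>
definition W_integrand ::
  "real \<Rightarrow> real \<Rightarrow> real \<Rightarrow> (real \<Rightarrow> real) \<Rightarrow> real \<Rightarrow> real \<Rightarrow> real" where
  "W_integrand r0 k l f lam s =
     (bessel_J k (lam * s) * bessel_Y l (lam * r0) - bessel_Y k (lam * s) * bessel_J l (lam * r0))
       / sqrt ((bessel_J l (lam * r0))\<^sup>2 + (bessel_Y l (lam * r0))\<^sup>2) * f s * s"

definition W_converges ::
  "real \<Rightarrow> real \<Rightarrow> real \<Rightarrow> (real \<Rightarrow> real) \<Rightarrow> real \<Rightarrow> bool" where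
  "W_converges r0 k l f lam \<longleftrightarrow>
     (\<forall>R>r0. set_integrable lebesgue {r0<..R} (W_integrand r0 k l f lam)) \<and>
     (\<exists>L. ((\<lambda>R. LINT s:{r0<..R}|lebesgue. W_integrand r0 k l f lam s) \<longlongrightarrow> L) at_top)"

definition W ::
  "real \<Rightarrow> real \<Rightarrow> real \<Rightarrow> (real \<Rightarrow> real) \<Rightarrow> real \<Rightarrow> real" where
  "W r0 k l f lam = Lim at_top (\<lambda>R. LINT s:{r0<..R}|lebesgue. W_integrand r0 k l f lam s)"

text \<open>\<open>L\<^sub>2(r\<^sub>0,\<infinity>;r)\<close>, at the level of representatives; only the values on \<open>(r\<^sub>0,\<infinity>)\<close> matter.\<close>
definition L2_weighted :: "real \<Rightarrow> (real \<Rightarrow> real) set" where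
  "L2_weighted r0 =
     {f. set_borel_measurable lebesgue {r0<..} f \<and>
         set_integrable lebesgue {r0<..} (\<lambda>r. (f r)\<^sup>2 * r)}"

end

theory Submission
  imports Defs "HOL-Complex_Analysis.Cauchy_Integral_Formula"
begin

text \<open>
  Let \<open>v\<close> be the cross product \<open>J\<^sub>l(z) Y\<^sub>l(\<lambda>r\<^sub>0) - Y\<^sub>l(z) J\<^sub>l(\<lambda>r\<^sub>0)\<close>, which vanishes at \<open>z = \<lambda>r\<^sub>0\<close>.
  The rules \<open>(z\<^sup>-\<^sup>l C\<^sub>l)' = - z\<^sup>-\<^sup>l C\<^bsub>l+1\<^esub>\<close> and \<open>(z\<^sup>l C\<^sub>l)' = z\<^sup>l C\<^bsub>l-1\<^esub>\<close> for \<open>C = J, Y\<close> turn the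
  integrand into the derivative of a constant multiple of \<open>s\<^bsup>1-k\<^esup> v(\<lambda>s)\<close> (with \<open>l = k - 1\<close>) or
  \<open>s\<^bsup>k+1\<^esup> v(\<lambda>s)\<close> (with \<open>l = k + 1\<close>). This antiderivative vanishes at \<open>r\<^sub>0\<close>, and it tends to \<open>0\<close>
  because the exponent is negative and \<open>v\<close> is bounded, by an energy estimate for the first order
  system of \<open>C\<^sub>\<mu>, C\<^bsub>\<mu>+1\<^esub>\<close>. At integer order the rules for \<open>Y\<close> follow from
  \<open>\<pi> Y\<^sub>n = D\<^sub>n + (-1)\<^sup>n D\<^bsub>-n\<^esub>\<close>, where \<open>D\<^sub>\<nu>\<close> is the derivative of \<open>J\<^sub>\<nu>\<close> in its order.
\<close>

section \<open>Bessel-type series\<close>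

text \<open>The rate \<open>2 ^ m\<close> is harmless against the \<open>1 / fact m\<close> of the
  series, and a doubling estimate for \<open>rGamma\<close> and its derivative delivers it.
  \<open>B\<close> is explicit so that it can be kept uniform in the order.\<close>

definition geometric_bound :: "real \<Rightarrow> (nat \<Rightarrow> real) \<Rightarrow> bool" where
  "geometric_bound B c \<longleftrightarrow> (\<forall>m. \<bar>c m\<bar> \<le> B * 2 ^ m)"

text \<open>J_\<nu> (coefficients from \<open>rGamma\<close>) and the non-logarithmic part of its
  derivative in the order (coefficients from \<open>deriv rGamma\<close>) both have this shape, so
  the calculus in \<open>x\<close> is done once for general \<open>c\<close>.\<close>

definition bessel_series :: "real \<Rightarrow> (nat \<Rightarrow> real) \<Rightarrow> real \<Rightarrow> real" where
  "bessel_series \<nu> c x = (\<Sum>m. (-1) ^ m / fact m * c m * (x / 2) powr (2 * real m + \<nu>))"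

lemma summable_exp_majorant: "summable (\<lambda>m. B * ((2 * y) ^ m / fact m) :: real)"
  using summable_exp[of "2 * y"] by (intro summable_mult) (simp add: field_simps)

lemma alternating_term_bound:
  fixes y :: real
  assumes "geometric_bound B c"
  shows "\<bar>(-1) ^ m / fact m * c m * y ^ m\<bar> \<le> B * ((2 * \<bar>y\<bar>) ^ m / fact m)"
proof -
  have "\<bar>(-1) ^ m / fact m * c m * y ^ m\<bar> = \<bar>c m\<bar> * (\<bar>y\<bar> ^ m / fact m)"
    by (simp add: abs_mult power_abs)
  also have "\<dots> \<le> (B * 2 ^ m) * (\<bar>y\<bar> ^ m / fact m)"
    using assms by (intro mult_right_mono) (auto simp: geometric_bound_def)
  finally show ?thesis by (simp add: power_mult_distrib)
qed

lemma summable_alternating: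
  fixes y :: real
  assumes "geometric_bound B c"
  shows "summable (\<lambda>m. (-1) ^ m / fact m * c m * y ^ m)"
  by (rule summable_comparison_test'[OF summable_exp_majorant[of B "\<bar>y\<bar>"], of 0])
     (use alternating_term_bound[OF assms] in simp)

lemma geometric_bound_Suc:
  "geometric_bound B c \<Longrightarrow> geometric_bound (2 * B) (\<lambda>m. c (Suc m))"
  unfolding geometric_bound_def by (metis mult.assoc mult.commute power_Suc)

lemma geometric_bound_diff:
  "geometric_bound B c \<Longrightarrow> geometric_bound B' d \<Longrightarrow> geometric_bound (B + B') (\<lambda>m. c m - d m)"
  unfolding geometric_bound_def distrib_right
  by (blast intro: order_trans[OF abs_triangle_ineq4] add_mono)

text \<open>Since (m + 1) / (m + 1)! = 1 / m!, termwise differentiation only shifts the coefficients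
  and flips the sign.\<close>

lemma has_field_derivative_alternating:
  fixes t :: real
  assumes "geometric_bound B c"
  shows "((\<lambda>t. \<Sum>m. (-1) ^ m / fact m * c m * t ^ m) has_field_derivative
          - (\<Sum>m. (-1) ^ m / fact m * c (Suc m) * t ^ m)) (at t)"
proof -
  have "diffs (\<lambda>m. (-1) ^ m / fact m * c m) m = - ((-1) ^ m / fact m * c (Suc m))" for m
    by (simp add: diffs_def divide_simps del: of_nat_Suc)
  with termdiffs_strong_converges_everywhere[OF summable_alternating[OF assms], of t]
       suminf_minus[OF summable_alternating[OF geometric_bound_Suc[OF assms]], of t]
  show ?thesis by simp
qed

lemma bessel_series_eq:
  assumes "geometric_bound B c" "x > 0"
  shows "bessel_series \<nu> c x = (x / 2) powr \<nu> * (\<Sum>m. (-1) ^ m / fact m * c m * ((x / 2)\<^sup>2) ^ m)"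
proof -
  have "(x / 2) powr (2 * real m + \<nu>) = (x / 2) powr \<nu> * ((x / 2)\<^sup>2) ^ m" for m
    using assms powr_realpow[of "x / 2" "2 * m"] by (simp add: powr_add power_mult)
  then show ?thesis
    using suminf_mult[OF summable_alternating[OF assms(1), of "(x / 2)\<^sup>2"], of "(x / 2) powr \<nu>"]
    by (simp add: bessel_series_def mult_ac)
qed

text \<open>Product rule for \<open>(x / 2) powr \<nu>\<close> times a power series in (x/2)^2. The
  inner derivative \<open>x / 2\<close> raises the prefactor to order \<nu> + 1.\<close>

lemma has_field_derivative_bessel_series:
  assumes c: "geometric_bound B c" and x: "x > 0"
  shows "(bessel_series \<nu> c has_field_derivative
          \<nu> / x * bessel_series \<nu> c x - bessel_series (\<nu> + 1) (\<lambda>m. c (Suc m)) x) (at x)"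
proof -
  let ?S = "\<lambda>c t. \<Sum>m. (-1) ^ m / fact m * c m * t ^ m :: real"
  have inner: "((\<lambda>x. (x / 2)\<^sup>2) has_field_derivative x / 2) (at x)"
    by (auto intro!: derivative_eq_intros)
  have S: "((\<lambda>x. ?S c ((x / 2)\<^sup>2)) has_field_derivative
           - ?S (\<lambda>m. c (Suc m)) ((x / 2)\<^sup>2) * (x / 2)) (at x)"
    by (rule DERIV_chain2[OF has_field_derivative_alternating[OF c] inner])
  have p: "((\<lambda>x. (x / 2) powr \<nu>) has_field_derivative \<nu> / x * (x / 2) powr \<nu>) (at x)"
    using x by (auto intro!: derivative_eq_intros simp: powr_diff field_simps)
  have "((\<lambda>x. (x / 2) powr \<nu> * ?S c ((x / 2)\<^sup>2)) has_field_derivative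
         (\<nu> / x * (x / 2) powr \<nu>) * ?S c ((x / 2)\<^sup>2)
         + (- ?S (\<lambda>m. c (Suc m)) ((x / 2)\<^sup>2) * (x / 2)) * (x / 2) powr \<nu>) (at x)"
    by (rule DERIV_mult[OF p S])
  also have "(\<nu> / x * (x / 2) powr \<nu>) * ?S c ((x / 2)\<^sup>2)
         + (- ?S (\<lambda>m. c (Suc m)) ((x / 2)\<^sup>2) * (x / 2)) * (x / 2) powr \<nu>
       = \<nu> / x * bessel_series \<nu> c x - bessel_series (\<nu> + 1) (\<lambda>m. c (Suc m)) x"
    using x by (simp add: bessel_series_eq[OF c] bessel_series_eq[OF geometric_bound_Suc[OF c]] powr_add mult_ac)
  finally show ?thesis
    by (rule has_field_derivative_transform_within_open[of _ _ _ "{0<..}"])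
       (use x in \<open>auto simp: bessel_series_eq[OF c]\<close>)
qed

text \<open>For \<open>rGamma\<close> coefficients the weight m + \<nu> produces exactly those of
  order \<nu> - 1, which gives the three-term recurrence. The part with weight m is a shifted
  series, as m / m! = 1 / (m - 1)!.\<close>

lemma bessel_series_recurrence:
  assumes c: "geometric_bound B c" and c': "geometric_bound B' (\<lambda>m. (real m + \<nu>) * c m)" and x: "x > 0"
  shows "bessel_series (\<nu> - 1) (\<lambda>m. (real m + \<nu>) * c m) x =
         2 * \<nu> / x * bessel_series \<nu> c x - bessel_series (\<nu> + 1) (\<lambda>m. c (Suc m)) x"
proof -
  let ?S = "\<lambda>c t. \<Sum>m. (-1) ^ m / fact m * c m * t ^ m :: real"
  define t where "t = (x / 2)\<^sup>2"
  have sc: "summable (\<lambda>m. (-1) ^ m / fact m * c m * t ^ m)" by (rule summable_alternating[OF c])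
  have sc': "summable (\<lambda>m. (-1) ^ m / fact m * ((real m + \<nu>) * c m) * t ^ m)"
    by (rule summable_alternating[OF c'])
  \<comment> \<open>The coefficients m * c m carry no bound of their own; they are the difference of
    (m + \<nu>) * c m and \<nu> * c m.\<close>
  have sm: "summable (\<lambda>m. real m * ((-1) ^ m / fact m * c m * t ^ m))"
    using summable_diff[OF sc' summable_mult[OF sc, of \<nu>]] by (simp add: algebra_simps)
  have "(\<Sum>m. real m * ((-1) ^ m / fact m * c m * t ^ m)) =
        (\<Sum>m. real (Suc m) * ((-1) ^ Suc m / fact (Suc m) * c (Suc m) * t ^ Suc m))"
    using suminf_split_head[OF sm] by simp
  also have "\<dots> = (\<Sum>m. - t * ((-1) ^ m / fact m * c (Suc m) * t ^ m))"
    by (intro suminf_cong) (simp add: divide_simps del: of_nat_Suc)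
  also have "\<dots> = - t * ?S (\<lambda>m. c (Suc m)) t"
    by (rule suminf_mult[OF summable_alternating[OF geometric_bound_Suc[OF c]]])
  finally have S: "?S (\<lambda>m. (real m + \<nu>) * c m) t = - t * ?S (\<lambda>m. c (Suc m)) t + \<nu> * ?S c t"
    using suminf_add[OF sm summable_mult[OF sc, of \<nu>]] suminf_mult[OF sc, of \<nu>]
    by (simp add: algebra_simps)
  have up: "(x / 2) powr (\<nu> - 1) * t = (x / 2) powr (\<nu> + 1)"
    using x by (simp add: t_def powr_diff powr_add power2_eq_square)
  have down: "(x / 2) powr (\<nu> - 1) = 2 / x * (x / 2) powr \<nu>"
    using x by (simp add: powr_diff)
  have "bessel_series (\<nu> - 1) (\<lambda>m. (real m + \<nu>) * c m) x =
      (x / 2) powr (\<nu> - 1) * (- t * ?S (\<lambda>m. c (Suc m)) t + \<nu> * ?S c t)"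
    unfolding bessel_series_eq[OF c' x] t_def[symmetric] S ..
  also have "\<dots> = \<nu> * (x / 2) powr (\<nu> - 1) * ?S c t - (x / 2) powr (\<nu> - 1) * t * ?S (\<lambda>m. c (Suc m)) t"
    by algebra
  also have "\<dots> = 2 * \<nu> / x * ((x / 2) powr \<nu> * ?S c t) - (x / 2) powr (\<nu> + 1) * ?S (\<lambda>m. c (Suc m)) t"
    unfolding up unfolding down by simp
  finally show ?thesis
    unfolding bessel_series_eq[OF c x] bessel_series_eq[OF geometric_bound_Suc[OF c] x] t_def .
qed

lemma bessel_series_diff:
  assumes "geometric_bound B c" "geometric_bound B' d" "x > 0"
  shows "bessel_series \<nu> (\<lambda>m. c m - d m) x = bessel_series \<nu> c x - bessel_series \<nu> d x"
proof -
  have "geometric_bound (B + B') (\<lambda>m. c m - d m)"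
    by (rule geometric_bound_diff[OF assms(1,2)])
  then show ?thesis
    using suminf_diff[OF summable_alternating[OF assms(1), of "(x / 2)\<^sup>2"]
            summable_alternating[OF assms(2), of "(x / 2)\<^sup>2"], symmetric] assms
    by (simp add: bessel_series_eq left_diff_distrib right_diff_distrib)
qed

lemma bessel_series_reindex:
  assumes "geometric_bound B c" "x > 0"
  shows "bessel_series (\<nu> - 1) c x = 2 / x * bessel_series \<nu> c x"
  using assms by (simp add: bessel_series_eq powr_diff)

section \<open>The function \<open>J\<close> and its derivative in the order\<close>

lemma rGamma_real_has_deriv: "(rGamma has_field_derivative deriv rGamma z) (at (z::real) within A)"
  by (metis DERIV_imp_deriv has_field_derivative_at_within has_field_derivative_rGamma)

text \<open>Differentiate the functional equation
  \<open>rGamma z = z * rGamma (z + 1)\<close>.\<close>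

lemma deriv_rGamma_shift: "deriv rGamma (z::real) = rGamma (z + 1) + z * deriv rGamma (z + 1)"
proof -
  have "((\<lambda>z. z * rGamma (z + 1)) has_field_derivative rGamma (z + 1) + z * deriv rGamma (z + 1)) (at z)"
    by (rule derivative_eq_intros DERIV_chain2[OF rGamma_real_has_deriv] refl | simp)+
  then have "(rGamma has_field_derivative rGamma (z + 1) + z * deriv rGamma (z + 1)) (at z)"
    by (simp add: rGamma_plus1)
  then show ?thesis by (rule DERIV_imp_deriv)
qed

text \<open>Serves the continuity of the real derivative: in the complex plane \<open>rGamma\<close>
  is entire, so its derivative is holomorphic.\<close>

lemma deriv_rGamma_real: "deriv rGamma (x::real) = Re (deriv rGamma (of_real x :: complex))"
proof -
  have "(rGamma has_field_derivative deriv rGamma (of_real x)) (at (of_real x :: complex))"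
    by (metis DERIV_imp_deriv has_field_derivative_rGamma)
  from has_vector_derivative_real_field[OF this]
  have "((\<lambda>x. rGamma (of_real x :: complex)) has_vector_derivative deriv rGamma (of_real x :: complex)) (at x)" 
    by simp
  then have "((\<lambda>x. Re (rGamma (of_real x :: complex))) has_field_derivative Re (deriv rGamma (of_real x :: complex))) (at x)"
    by (rule has_field_derivative_Re)
  then show ?thesis
    by (intro DERIV_imp_deriv) (simp add: rGamma_complex_of_real)
qed

lemma continuous_on_deriv_rGamma_real: "continuous_on A (deriv rGamma :: real \<Rightarrow> real)"
proof -
  have "continuous_on UNIV (deriv (rGamma :: complex \<Rightarrow> complex))"
    by (intro holomorphic_on_imp_continuous_on holomorphic_deriv holomorphic_rGamma) auto
  then have "continuous_on A (\<lambda>x. deriv rGamma (of_real x :: complex))"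
    by (rule continuous_on_compose2[OF _ continuous_on_of_real_id]) simp
  from continuous_on_Re[OF this] show ?thesis
    by (simp add: deriv_rGamma_real cong: continuous_on_cong)
qed

text \<open>The Weierstrass test in the order calls for one \<open>B\<close> on a whole interval of
  orders. Compactness covers the first indices, a doubling estimate the rest.\<close>

lemma rGamma_geometric_bounds:
  fixes a b :: real
  shows "\<exists>B. \<forall>\<nu>\<in>{a..b}. geometric_bound B (\<lambda>m. rGamma (real m + \<nu> + 1)) \<and>
                     geometric_bound B (\<lambda>m. deriv rGamma (real m + \<nu> + 1))"
proof -
  \<comment> \<open>The sum is tracked because the recursion for the derivative also feeds on
    \<open>rGamma\<close>; for z >= 1 this costs at most a factor 2.\<close>
  define q where "q z = \<bar>rGamma z\<bar> + \<bar>deriv rGamma z\<bar>" for z :: real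
  have dbl: "q (z + 1) \<le> 2 * q z" if "z \<ge> 1" for z
  proof -
    have 1: "rGamma (z + 1) = rGamma z / z" using rGamma_plus1[of z] that by (simp add: field_simps)
    have 2: "deriv rGamma (z + 1) = (deriv rGamma z - rGamma (z + 1)) / z"
      using deriv_rGamma_shift[of z] that by (simp add: field_simps)
    have div: "\<bar>u / z\<bar> \<le> \<bar>u\<bar>" for u
      using that by (simp add: abs_divide divide_le_eq mult_le_cancel_left1)
    have "\<bar>rGamma (z + 1)\<bar> \<le> \<bar>rGamma z\<bar>" using div 1 by simp
    moreover have "\<bar>deriv rGamma (z + 1)\<bar> \<le> \<bar>deriv rGamma z - rGamma (z + 1)\<bar>" using div 2 by simp
    ultimately show ?thesis
      unfolding q_def using abs_triangle_ineq4[of "deriv rGamma z" "rGamma (z + 1)"] by argo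
  qed
  \<comment> \<open>From index \<open>N\<close> on the argument is at least 1, where doubling
    applies; up to index \<open>N\<close> it stays in the compact interval
    \<open>{a + 1..b + 1 + real N}\<close>.\<close>
  obtain N :: nat where N: "real N \<ge> - a" using real_arch_simple by blast
  have "compact (q ` {a + 1..b + 1 + real N})"
    unfolding q_def
    by (intro compact_continuous_image continuous_intros continuous_on_deriv_rGamma_real) auto
  then obtain B where "B > 0" "\<forall>y\<in>q ` {a + 1..b + 1 + real N}. norm y \<le> B"
    using compact_imp_bounded bounded_pos by blast
  then have B: "\<And>z. z \<in> {a + 1..b + 1 + real N} \<Longrightarrow> q z \<le> B" "B > 0"
    by (force, simp)
  have main: "q (real m + \<nu> + 1) \<le> B * 2 ^ m" if \<nu>: "a \<le> \<nu>" "\<nu> \<le> b" for m \<nu>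
  proof (induction m)
    case 0
    show ?case using B(1)[of "\<nu> + 1"] \<nu> by simp
  next
    case (Suc m)
    show ?case
    proof (cases "Suc m \<le> N")
      case True
      have "q (real (Suc m) + \<nu> + 1) \<le> B * 1" using B(1)[of "real (Suc m) + \<nu> + 1"] \<nu> True by simp
      also have "\<dots> \<le> B * 2 ^ Suc m" using B(2) by (intro mult_left_mono one_le_power) auto
      finally show ?thesis .
    next
      case False
      then have "real N \<le> real m" by simp
      with N \<nu> have "real m + \<nu> + 1 \<ge> 1" by linarith
      from dbl[OF this] Suc.IH show ?thesis by (simp add: add_ac)
    qed
  qed
  have "\<bar>rGamma (real m + \<nu> + 1)\<bar> \<le> B * 2 ^ m \<and> \<bar>deriv rGamma (real m + \<nu> + 1)\<bar> \<le> B * 2 ^ m"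
    if "\<nu> \<in> {a..b}" for m \<nu>
    using main[of \<nu> m] that unfolding q_def by auto
  then show ?thesis unfolding geometric_bound_def by blast
qed

lemma rGamma_geometric_bound:
  "\<exists>B. geometric_bound B (\<lambda>m. rGamma (real m + \<nu> + 1))"
  "\<exists>B. geometric_bound B (\<lambda>m. deriv rGamma (real m + \<nu> + 1))"
proof -
  obtain B where B: "\<forall>\<mu>\<in>{\<nu>..\<nu>}. geometric_bound B (\<lambda>m. rGamma (real m + \<mu> + 1)) \<and>
      geometric_bound B (\<lambda>m. deriv rGamma (real m + \<mu> + 1))"
    using rGamma_geometric_bounds[of \<nu> \<nu>] ..
  show "\<exists>B. geometric_bound B (\<lambda>m. rGamma (real m + \<nu> + 1))"
    using B by (intro exI[of _ B]) simp
  show "\<exists>B. geometric_bound B (\<lambda>m. deriv rGamma (real m + \<nu> + 1))"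
    using B by (intro exI[of _ B]) simp
qed

section \<open>Rules for J and its order derivative\<close>

lemma bessel_J_eq_series: "bessel_J \<nu> = bessel_series \<nu> (\<lambda>m. rGamma (real m + \<nu> + 1))"
  by (simp add: bessel_J_def bessel_series_def fun_eq_iff)

lemma bessel_J_deriv_up:
  assumes "x > 0"
  shows "(bessel_J \<nu> has_field_derivative \<nu> / x * bessel_J \<nu> x - bessel_J (\<nu> + 1) x) (at x)"
proof -
  obtain B where "geometric_bound B (\<lambda>m. rGamma (real m + \<nu> + 1))"
    using rGamma_geometric_bound(1)[of \<nu>] ..
  from has_field_derivative_bessel_series[OF this assms, of \<nu>] show ?thesis
    by (simp add: bessel_J_eq_series add_ac)
qed

lemma bessel_J_recurrence:
  assumes "x > 0"
  shows "bessel_J (\<nu> - 1) x = 2 * \<nu> / x * bessel_J \<nu> x - bessel_J (\<nu> + 1) x"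
proof -
  obtain B where B: "geometric_bound B (\<lambda>m. rGamma (real m + \<nu> + 1))"
    using rGamma_geometric_bound(1)[of \<nu>] ..
  obtain B' where B': "geometric_bound B' (\<lambda>m. rGamma (real m + (\<nu> - 1) + 1))"
    using rGamma_geometric_bound(1)[of "\<nu> - 1"] ..
  have "(real m + \<nu>) * rGamma (real m + \<nu> + 1) = rGamma (real m + (\<nu> - 1) + 1)" for m
    using rGamma_plus1[of "real m + \<nu>"] by simp
  then show ?thesis
    using bessel_series_recurrence[OF B _ assms, of B' \<nu>] B' by (simp add: bessel_J_eq_series add_ac)
qed

text \<open>The derivative of J_\<nu> in \<nu>: the logarithm comes from the power prefactor, the
  series from the coefficients.\<close>

definition bessel_J_dorder :: "real \<Rightarrow> real \<Rightarrow> real" where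
  "bessel_J_dorder \<nu> x =
     ln (x / 2) * bessel_J \<nu> x + bessel_series \<nu> (\<lambda>m. deriv rGamma (real m + \<nu> + 1)) x"

text \<open>Termwise differentiation in the order: the differentiated series converges uniformly on
  the interval of radius 1 around \<nu>.\<close>

lemma has_field_derivative_bessel_J_order:
  assumes x: "x > 0"
  shows "((\<lambda>\<nu>. bessel_J \<nu> x) has_field_derivative bessel_J_dorder \<nu> x) (at \<nu>)"
proof -
  obtain B where B: "\<And>\<mu>. \<lbrakk>\<nu> - 1 \<le> \<mu>; \<mu> \<le> \<nu> + 1\<rbrakk> \<Longrightarrow> geometric_bound B (\<lambda>m. rGamma (real m + \<mu> + 1))"
    and B': "\<And>\<mu>. \<lbrakk>\<nu> - 1 \<le> \<mu>; \<mu> \<le> \<nu> + 1\<rbrakk> \<Longrightarrow> geometric_bound B (\<lambda>m. deriv rGamma (real m + \<mu> + 1))"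
  proof -
    from rGamma_geometric_bounds[of "\<nu> - 1" "\<nu> + 1"] obtain B where
      "\<forall>\<mu>\<in>{\<nu> - 1..\<nu> + 1}. geometric_bound B (\<lambda>m. rGamma (real m + \<mu> + 1)) \<and>
                         geometric_bound B (\<lambda>m. deriv rGamma (real m + \<mu> + 1))" ..
    then show thesis by (intro that[of B]) auto
  qed
  define t where "t = (x / 2)\<^sup>2"
  define I where "I = {\<nu> - 1..\<nu> + 1}"
  define f where "f m \<mu> = (-1) ^ m / fact m * rGamma (real m + \<mu> + 1) * t ^ m" for m \<mu>
  define f' where "f' m \<mu> = (-1) ^ m / fact m * deriv rGamma (real m + \<mu> + 1) * t ^ m" for m \<mu>
  have unif: "uniformly_convergent_on I (\<lambda>n \<mu>. \<Sum>i<n. f' i \<mu>)"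
    by (rule Weierstrass_m_test'[OF _ summable_exp_majorant[of B "\<bar>t\<bar>"]])
       (use alternating_term_bound[OF B'] in \<open>auto simp: f'_def I_def\<close>)
  have termwise: "(f m has_field_derivative f' m \<mu>) (at \<mu> within I)" for m \<mu>
    unfolding f_def f'_def
    by (rule derivative_eq_intros DERIV_chain2[OF rGamma_real_has_deriv] refl | simp)+
  have "((\<lambda>\<mu>. \<Sum>m. f m \<mu>) has_field_derivative (\<Sum>m. f' m \<nu>)) (at \<nu>)"
  proof (rule has_field_derivative_series'[where S=I and x0=\<nu>])
    show "summable (\<lambda>n. f n \<nu>)" unfolding f_def by (rule summable_alternating[OF B]) auto
  qed (use unif termwise in \<open>auto simp: I_def\<close>)
  moreover have "((\<lambda>\<mu>. (x / 2) powr \<mu>) has_field_derivative ln (x / 2) * (x / 2) powr \<nu>) (at \<nu>)"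
    using x by (auto intro!: derivative_eq_intros)
  ultimately have "((\<lambda>\<mu>. (x / 2) powr \<mu> * (\<Sum>m. f m \<mu>)) has_field_derivative
      (ln (x / 2) * (x / 2) powr \<nu>) * (\<Sum>m. f m \<nu>) + (\<Sum>m. f' m \<nu>) * (x / 2) powr \<nu>) (at \<nu>)"
    by (rule DERIV_mult[rotated])
  moreover have "(ln (x / 2) * (x / 2) powr \<nu>) * (\<Sum>m. f m \<nu>) + (\<Sum>m. f' m \<nu>) * (x / 2) powr \<nu>
     = bessel_J_dorder \<nu> x"
    using bessel_series_eq[OF B x, of \<nu> \<nu>] bessel_series_eq[OF B' x, of \<nu> \<nu>]
    by (simp add: bessel_J_dorder_def bessel_J_eq_series f_def f'_def t_def)
  ultimately have "((\<lambda>\<mu>. (x / 2) powr \<mu> * (\<Sum>m. f m \<mu>)) has_field_derivative bessel_J_dorder \<nu> x) (at \<nu>)"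
    by simp
  then show ?thesis
    by (rule has_field_derivative_transform_within_open[of _ _ _ "{\<nu> - 1<..<\<nu> + 1}"])
       (use bessel_series_eq[OF B x] in \<open>auto simp: bessel_J_eq_series f_def t_def\<close>)
qed

text \<open>Formally the rule for J differentiated in \<nu>. It is proved on the series, so no
  partial derivatives are exchanged; the term with J / x comes from the logarithm.\<close>

lemma bessel_J_dorder_deriv:
  assumes "x > 0"
  shows "(bessel_J_dorder \<nu> has_field_derivative
          \<nu> / x * bessel_J_dorder \<nu> x + bessel_J \<nu> x / x - bessel_J_dorder (\<nu> + 1) x) (at x)"
proof -
  let ?c = "\<lambda>m. deriv rGamma (real m + \<nu> + 1)"
  obtain B where B: "geometric_bound B ?c"
    using rGamma_geometric_bound(2)[of \<nu>] ..
  have ln: "((\<lambda>x. ln (x / 2)) has_field_derivative 1 / x) (at x)"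
    using assms by (auto intro!: derivative_eq_intros)
  show ?thesis
    unfolding bessel_J_dorder_def[abs_def]
  proof (rule DERIV_cong)
    show "((\<lambda>x. ln (x / 2) * bessel_J \<nu> x + bessel_series \<nu> ?c x) has_field_derivative
       (1 / x * bessel_J \<nu> x + (\<nu> / x * bessel_J \<nu> x - bessel_J (\<nu> + 1) x) * ln (x / 2))
        + (\<nu> / x * bessel_series \<nu> ?c x - bessel_series (\<nu> + 1) (\<lambda>m. ?c (Suc m)) x)) (at x)"
      using ln bessel_J_deriv_up[OF assms] has_field_derivative_bessel_series[OF B assms]
      by (intro DERIV_add DERIV_mult)
  qed (simp add: algebra_simps add_divide_distrib)
qed

text \<open>The shift rule for \<open>deriv rGamma\<close> leaves a remainder \<open>rGamma\<close>,
  which accounts for the term \<open>2 / x * bessel_J \<nu> x\<close>.\<close>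

lemma bessel_J_dorder_recurrence:
  assumes x: "x > 0"
  shows "bessel_J_dorder (\<nu> - 1) x =
    2 * \<nu> / x * bessel_J_dorder \<nu> x + 2 / x * bessel_J \<nu> x - bessel_J_dorder (\<nu> + 1) x"
proof -
  let ?c = "\<lambda>m. deriv rGamma (real m + \<nu> + 1)"
  let ?g = "\<lambda>m. rGamma (real m + \<nu> + 1)"
  let ?d = "\<lambda>m. deriv rGamma (real m + (\<nu> - 1) + 1)"
  obtain B where B: "geometric_bound B ?c"
    using rGamma_geometric_bound(2)[of \<nu>] ..
  obtain B'' where B'': "geometric_bound B'' ?g"
    using rGamma_geometric_bound(1)[of \<nu>] ..
  obtain B' where B': "geometric_bound B' ?d"
    using rGamma_geometric_bound(2)[of "\<nu> - 1"] ..
  have eq: "(real m + \<nu>) * ?c m = ?d m - ?g m" for m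
    using deriv_rGamma_shift[of "real m + \<nu>"] by simp
  have "geometric_bound (B' + B'') (\<lambda>m. ?d m - ?g m)"
    by (rule geometric_bound_diff[OF B' B''])
  then have "bessel_series (\<nu> - 1) (\<lambda>m. ?d m - ?g m) x
      = 2 * \<nu> / x * bessel_series \<nu> ?c x - bessel_series (\<nu> + 1) (\<lambda>m. ?c (Suc m)) x"
    using bessel_series_recurrence[OF B _ x, of "B' + B''" \<nu>] by (simp add: eq)
  then have "bessel_series (\<nu> - 1) ?d x - 2 / x * bessel_J \<nu> x
      = 2 * \<nu> / x * bessel_series \<nu> ?c x - bessel_series (\<nu> + 1) (\<lambda>m. ?c (Suc m)) x"
    unfolding bessel_series_diff[OF B' B'' x] bessel_series_reindex[OF B'' x] bessel_J_eq_series .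
  then show ?thesis
    unfolding bessel_J_dorder_def bessel_J_recurrence[OF x]
    by (simp add: algebra_simps)
qed

section \<open>The function \<open>Y\<close>\<close>

text \<open>The recurrences at orders n + 1 and -(n + 1) differ only in the sign of the middle
  coefficient, which the alternating factor absorbs. The recurrence at order 0 gives the case n =
  1.\<close>

lemma bessel_J_minus_nat:
  assumes x: "x > 0"
  shows "bessel_J (- real n) x = (-1) ^ n * bessel_J (real n) x"
proof (induction n rule: induct_nat_012)
  case 0
  show ?case by simp
next
  case 1
  show ?case using bessel_J_recurrence[OF x, of 0] by simp
next
  case (ge2 n)
  have minus: "bessel_J (- real (Suc (Suc n))) x =
      - 2 * (real n + 1) / x * bessel_J (- real (Suc n)) x - bessel_J (- real n) x"
    using bessel_J_recurrence[OF x, of "- real (Suc n)"] by (simp add: algebra_simps)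
  have plus: "bessel_J (real (Suc (Suc n))) x =
      2 * (real n + 1) / x * bessel_J (real (Suc n)) x - bessel_J (real n) x"
    using bessel_J_recurrence[OF x, of "real (Suc n)"] by (simp add: algebra_simps)
  show ?case
    unfolding minus plus ge2.IH by (simp add: algebra_simps)
qed

lemma cos_of_int_pi_square: "n \<in> \<int> \<Longrightarrow> cos (n * pi) * cos (n * pi) = (1::real)"
  using sin_times_pi_eq_0[of n] sin_cos_squared_add[of "n * pi"] by (simp add: power2_eq_square)

lemma bessel_J_minus_Ints:
  assumes x: "x > 0" and k: "k \<in> \<int>"
  shows "bessel_J (- k) x = cos (k * pi) * bessel_J k x"
proof -
  have nat: "bessel_J (- real n) x = cos (real n * pi) * bessel_J (real n) x" for n
    using bessel_J_minus_nat[OF x, of n] by (simp add: cos_npi)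
  obtain j where j: "k = of_int j" using k by (auto elim: Ints_cases)
  show ?thesis
  proof (cases "j \<ge> 0")
    case True
    then show ?thesis using nat[of "nat j"] j by simp
  next
    case False
    then have "bessel_J k x = cos (k * pi) * bessel_J (- k) x" using nat[of "nat (- j)"] j by simp
    then show ?thesis using cos_of_int_pi_square[OF k] by (metis mult.assoc mult_1)
  qed
qed

text \<open>L'Hopital's rule: numerator and denominator of \<open>bessel_Y_quot\<close> both vanish
  at an integer order, so the limit is the quotient of their derivatives in the order. As the cosine
  squares to 1, it can move from the denominator to the numerator.\<close>

lemma bessel_Y_Ints:
  assumes x: "x > 0" and k: "k \<in> \<int>"
  shows "bessel_Y k x = (bessel_J_dorder k x + cos (k * pi) * bessel_J_dorder (- k) x) / pi"
proof -
  define N where "N \<nu> = bessel_J \<nu> x * cos (\<nu> * pi) - bessel_J (- \<nu>) x" for \<nu>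
  have sin: "sin (k * pi) = 0" using sin_times_pi_eq_0 k by blast
  have sq: "cos (k * pi) * cos (k * pi) = 1" by (rule cos_of_int_pi_square[OF k])
  have N0: "N k = 0" using bessel_J_minus_Ints[OF x k] by (simp add: N_def)
  have dminus: "((\<lambda>\<nu>. bessel_J (- \<nu>) x) has_field_derivative - bessel_J_dorder (- k) x) (at k)"
    using DERIV_chain2[OF has_field_derivative_bessel_J_order[OF x, of "- k"] DERIV_minus[OF DERIV_ident]]
    by simp
  have dcos: "((\<lambda>\<nu>. cos (\<nu> * pi)) has_field_derivative 0) (at k)"
    by (auto intro!: derivative_eq_intros simp: sin)
  have "(N has_field_derivative bessel_J_dorder k x * cos (k * pi) + bessel_J_dorder (- k) x) (at k)"
    unfolding N_def[abs_def]
    using DERIV_diff[OF DERIV_mult[OF has_field_derivative_bessel_J_order[OF x, of k] dcos] dminus]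
    by simp
  then have num: "((\<lambda>\<nu>. N \<nu> / (\<nu> - k)) \<longlongrightarrow> bessel_J_dorder k x * cos (k * pi) + bessel_J_dorder (- k) x) (at k)"
    by (simp add: has_field_derivative_iff N0)
  have "((\<lambda>\<nu>. sin (\<nu> * pi)) has_field_derivative cos (k * pi) * pi) (at k)"
    by (auto intro!: derivative_eq_intros)
  then have den: "((\<lambda>\<nu>. sin (\<nu> * pi) / (\<nu> - k)) \<longlongrightarrow> cos (k * pi) * pi) (at k)"
    by (simp add: has_field_derivative_iff sin)
  have "cos (k * pi) \<noteq> 0" using sq by auto
  then have "((\<lambda>\<nu>. (N \<nu> / (\<nu> - k)) / (sin (\<nu> * pi) / (\<nu> - k))) \<longlongrightarrow>
      (bessel_J_dorder k x * cos (k * pi) + bessel_J_dorder (- k) x) / (cos (k * pi) * pi)) (at k)"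
    by (intro tendsto_divide num den) simp
  \<comment> \<open>The filter \<open>at k\<close> leaves out \<nu> = k, so the factor \<nu> - k
    cancels.\<close>
  moreover have "eventually (\<lambda>\<nu>. (N \<nu> / (\<nu> - k)) / (sin (\<nu> * pi) / (\<nu> - k)) = bessel_Y_quot \<nu> x) (at k)"
    by (auto simp: eventually_at_filter N_def bessel_Y_quot_def)
  ultimately have "((\<lambda>\<nu>. bessel_Y_quot \<nu> x) \<longlongrightarrow>
      (bessel_J_dorder k x * cos (k * pi) + bessel_J_dorder (- k) x) / (cos (k * pi) * pi)) (at k)"
    by (rule Lim_transform_eventually)
  then have "bessel_Y k x = (bessel_J_dorder k x * cos (k * pi) + bessel_J_dorder (- k) x) / (cos (k * pi) * pi)"
    using k by (simp add: bessel_Y_def tendsto_Lim)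
  also have "\<dots> = (bessel_J_dorder k x + cos (k * pi) * bessel_J_dorder (- k) x) / pi"
    using sq \<open>cos (k * pi) \<noteq> 0\<close> by (simp add: divide_simps) algebra
  finally show ?thesis .
qed

section \<open>Downward rules, and the rules for Y at all real orders\<close>

lemma bessel_J_deriv_down:
  assumes "x > 0"
  shows "(bessel_J \<nu> has_field_derivative bessel_J (\<nu> - 1) x - \<nu> / x * bessel_J \<nu> x) (at x)"
  by (rule DERIV_cong[OF bessel_J_deriv_up[OF assms]])
     (simp add: bessel_J_recurrence[OF assms, of \<nu>] algebra_simps)

lemma bessel_J_dorder_deriv_down:
  assumes "x > 0"
  shows "(bessel_J_dorder \<nu> has_field_derivative
          bessel_J_dorder (\<nu> - 1) x - \<nu> / x * bessel_J_dorder \<nu> x - bessel_J \<nu> x / x) (at x)"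
  by (rule DERIV_cong[OF bessel_J_dorder_deriv[OF assms]])
     (simp add: bessel_J_dorder_recurrence[OF assms, of \<nu>] algebra_simps)

lemma Ints_add_1_iff: "(k::real) + 1 \<in> \<int> \<longleftrightarrow> k \<in> \<int>"
  by (metis Ints_1 Ints_add Ints_diff add_diff_cancel_right')

text \<open>Going from k to k + 1 flips the sign of both sine and cosine and lowers the order -k, so
  the upward rule is used at k and the downward rule at -k. At integers the same works for the order
  derivatives; their extra terms J / x cancel because J_k = cos(k pi) J_{-k}.\<close>

lemma bessel_Y_deriv_up:
  assumes x: "x > 0"
  shows "(bessel_Y k has_field_derivative k / x * bessel_Y k x - bessel_Y (k + 1) x) (at x)"
proof (cases "k \<in> \<int>")
  case False
  define c where "c = cos (k * pi)"
  define s where "s = sin (k * pi)"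
  have cs: "cos ((k + 1) * pi) = - c" "sin ((k + 1) * pi) = - s"
    by (simp_all add: c_def s_def distrib_right)
  have Y: "bessel_Y k = (\<lambda>x. (bessel_J k x * c - bessel_J (- k) x) / s)"
    using False by (auto simp: bessel_Y_def bessel_Y_quot_def c_def s_def)
  have Y1: "bessel_Y (k + 1) x = (bessel_J (k + 1) x * c + bessel_J (- k - 1) x) / s"
    using False by (simp add: bessel_Y_def bessel_Y_quot_def Ints_add_1_iff cs add_divide_distrib diff_divide_distrib)
  have "s \<noteq> 0" using False by (simp add: s_def sin_times_pi_eq_0)
  then show ?thesis
    unfolding Y1 unfolding Y
    by (intro DERIV_cong[OF DERIV_cdivide[OF DERIV_diff[OF DERIV_cmult_right[OF bessel_J_deriv_up[OF x]]
          bessel_J_deriv_down[OF x, of "- k"]]]])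
       (use x in \<open>simp add: field_simps\<close>)
next
  case True
  define c where "c = cos (k * pi)"
  have c1: "cos ((k + 1) * pi) = - c"
    by (simp add: c_def distrib_right)
  have k1: "k + 1 \<in> \<int>" using True by simp
  have Y1: "bessel_Y (k + 1) x = (bessel_J_dorder (k + 1) x - c * bessel_J_dorder (- k - 1) x) / pi"
    unfolding bessel_Y_Ints[OF x k1] c1 by simp
  have Y: "bessel_Y k x = (bessel_J_dorder k x + c * bessel_J_dorder (- k) x) / pi" if "x > 0" for x
    unfolding bessel_Y_Ints[OF that True] c_def ..
  have cJ: "c * bessel_J (- k) x = bessel_J k x"
    using bessel_J_minus_Ints[OF x True] cos_of_int_pi_square[OF True] 
    by (simp add: c_def mult.assoc[symmetric])
  have "((\<lambda>x. (bessel_J_dorder k x + c * bessel_J_dorder (- k) x) / pi) has_field_derivative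
      ((k / x * bessel_J_dorder k x + bessel_J k x / x - bessel_J_dorder (k + 1) x)
       + c * (bessel_J_dorder (- k - 1) x - (- k) / x * bessel_J_dorder (- k) x - bessel_J (- k) x / x)) / pi) (at x)"
    by (intro DERIV_cdivide DERIV_add DERIV_cmult bessel_J_dorder_deriv bessel_J_dorder_deriv_down x)
  also have "((k / x * bessel_J_dorder k x + bessel_J k x / x - bessel_J_dorder (k + 1) x)
       + c * (bessel_J_dorder (- k - 1) x - (- k) / x * bessel_J_dorder (- k) x - bessel_J (- k) x / x)) / pi
     = k / x * bessel_Y k x - bessel_Y (k + 1) x"
    unfolding Y[OF x] Y1 cJ[symmetric] using x by (simp add: field_simps)
  finally show ?thesis
    by (rule has_field_derivative_transform_within_open[of _ _ _ "{0<..}"]) (use x Y in auto)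
qed

text \<open>Combines the recurrences at orders k and -k. At integers the extra J terms again cancel
  by the reflection J_k = cos(k pi) J_{-k}.\<close>

lemma bessel_Y_recurrence:
  assumes x: "x > 0"
  shows "bessel_Y (k - 1) x = 2 * k / x * bessel_Y k x - bessel_Y (k + 1) x"
proof (cases "k \<in> \<int>")
  case False
  define c where "c = cos (k * pi)"
  define s where "s = sin (k * pi)"
  have cs: "cos ((k + 1) * pi) = - c" "sin ((k + 1) * pi) = - s"
    "cos ((k - 1) * pi) = - c" "sin ((k - 1) * pi) = - s"
    by (simp_all add: c_def s_def distrib_right left_diff_distrib)
  have ni: "k + 1 \<notin> \<int>" "k - 1 \<notin> \<int>" using False Ints_add_1_iff[of k] Ints_add_1_iff[of "k - 1"] by simp_all
  have "s \<noteq> 0" using False by (simp add: s_def sin_times_pi_eq_0)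
  have Y: "bessel_Y (k + 1) x = (c * bessel_J (k + 1) x + bessel_J (- k - 1) x) / s"
    "bessel_Y (k - 1) x = (c * bessel_J (k - 1) x + bessel_J (- k + 1) x) / s"
    "bessel_Y k x = (c * bessel_J k x - bessel_J (- k) x) / s"
    using False ni \<open>s \<noteq> 0\<close>
    by (simp_all add: bessel_Y_def bessel_Y_quot_def cs c_def[symmetric] s_def[symmetric] divide_simps)
  have Jm: "bessel_J (- k - 1) x = 2 * (- k) / x * bessel_J (- k) x - bessel_J (- k + 1) x"
    by (rule bessel_J_recurrence[OF x])
  show ?thesis
    unfolding Y Jm bessel_J_recurrence[OF x, of k]
    using x \<open>s \<noteq> 0\<close> by (simp add: field_simps)
next
  case True
  define c where "c = cos (k * pi)"
  have c1: "cos ((k + 1) * pi) = - c" "cos ((k - 1) * pi) = - c"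
    by (simp_all add: c_def distrib_right left_diff_distrib)
  have cJ: "c * bessel_J (- k) x = bessel_J k x"
    using bessel_J_minus_Ints[OF x True] cos_of_int_pi_square[OF True] 
    by (simp add: c_def mult.assoc[symmetric])
  have Y: "bessel_Y (k + 1) x = (bessel_J_dorder (k + 1) x - c * bessel_J_dorder (- k - 1) x) / pi"
    "bessel_Y (k - 1) x = (bessel_J_dorder (k - 1) x - c * bessel_J_dorder (- k + 1) x) / pi"
    "bessel_Y k x = (bessel_J_dorder k x + c * bessel_J_dorder (- k) x) / pi"
    using bessel_Y_Ints[OF x, of "k + 1"] bessel_Y_Ints[OF x, of "k - 1"] bessel_Y_Ints[OF x, of k] True
    by (simp_all add: c1 c_def)
  have Dm: "bessel_J_dorder (- k - 1) x = 2 * (- k) / x * bessel_J_dorder (- k) x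
      + 2 / x * bessel_J (- k) x - bessel_J_dorder (- k + 1) x"
    by (rule bessel_J_dorder_recurrence[OF x])
  show ?thesis
    unfolding Y Dm bessel_J_dorder_recurrence[OF x, of k] cJ[symmetric]
    using x by (simp add: field_simps)
qed

section \<open>The first order system and the kernel\<close>

text \<open>Bessel's equation as a linear first order system for two neighbouring orders. The order
  l of the antiderivative is the first component when l = k - 1 and the second when l = k +
  1.\<close>

definition bessel_pair :: "real \<Rightarrow> (real \<Rightarrow> real) \<Rightarrow> (real \<Rightarrow> real) \<Rightarrow> bool" where
  "bessel_pair \<mu> a b \<longleftrightarrow> (\<forall>x>0.
     (a has_field_derivative \<mu> / x * a x - b x) (at x) \<and>
     (b has_field_derivative a x - (\<mu> + 1) / x * b x) (at x))"

lemma bessel_pair_J: "bessel_pair \<mu> (bessel_J \<mu>) (bessel_J (\<mu> + 1))"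
  unfolding bessel_pair_def
  using bessel_J_deriv_up bessel_J_deriv_down[of _ "\<mu> + 1"] by simp

lemma bessel_pair_Y: "bessel_pair \<mu> (bessel_Y \<mu>) (bessel_Y (\<mu> + 1))"
  unfolding bessel_pair_def
proof (intro allI impI conjI)
  fix x :: real assume x: "x > 0"
  show "(bessel_Y \<mu> has_field_derivative \<mu> / x * bessel_Y \<mu> x - bessel_Y (\<mu> + 1) x) (at x)"
    by (rule bessel_Y_deriv_up[OF x])
  show "(bessel_Y (\<mu> + 1) has_field_derivative bessel_Y \<mu> x - (\<mu> + 1) / x * bessel_Y (\<mu> + 1) x) (at x)"
    using bessel_Y_recurrence[OF x, of "\<mu> + 1"]
    by (intro DERIV_cong[OF bessel_Y_deriv_up[OF x, of "\<mu> + 1"]]) (simp add: algebra_simps)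
qed

lemma bessel_pair_combination:
  assumes "bessel_pair \<mu> a b" "bessel_pair \<mu> a' b'"
  shows "bessel_pair \<mu> (\<lambda>x. a x * p - a' x * q) (\<lambda>x. b x * p - b' x * q)"
  unfolding bessel_pair_def
proof (intro allI impI conjI)
  fix x :: real assume "x > 0"
  note d = assms[unfolded bessel_pair_def, rule_format, OF this]
  show "((\<lambda>x. a x * p - a' x * q) has_field_derivative
      \<mu> / x * (a x * p - a' x * q) - (b x * p - b' x * q)) (at x)"
    by (rule DERIV_cong[OF DERIV_diff[OF DERIV_cmult_right DERIV_cmult_right], OF conjunct1[OF d(1)] conjunct1[OF d(2)]])
       (simp add: algebra_simps)
  show "((\<lambda>x. b x * p - b' x * q) has_field_derivative
      (a x * p - a' x * q) - (\<mu> + 1) / x * (b x * p - b' x * q)) (at x)"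
    by (rule DERIV_cong[OF DERIV_diff[OF DERIV_cmult_right DERIV_cmult_right], OF conjunct2[OF d(1)] conjunct2[OF d(2)]])
       (simp add: algebra_simps)
qed

text \<open>Boundedness suffices later, since a negative power supplies the decay. For x >=
  \<open>X\<close> the corrected energy \<open>E\<close> is nonincreasing and at least half of a^2 +
  b^2.\<close>

lemma bessel_pair_bounded:
  assumes "bessel_pair \<mu> a b"
  shows "\<exists>M X. \<forall>x\<ge>X. \<bar>a x\<bar> \<le> M \<and> \<bar>b x\<bar> \<le> M"
proof -
  define c where "c = 2 * \<mu> + 1"
  define X where "X = \<bar>c\<bar> + 1"
  \<comment> \<open>Without the cross term one only gets \<open>O(x\<^bsup>2\<mu>\<^esup>)\<close>; this \<open>c\<close> balances both rates of change at \<open>- 1 / x\<close>.\<close>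
  define E where "E x = (a x)\<^sup>2 + (b x)\<^sup>2 - c * (a x * b x) / x" for x
  have X: "X > 0" by (simp add: X_def)
  \<comment> \<open>Used twice: it makes the derivative of \<open>E\<close> nonpositive and keeps
    the cross term of \<open>E\<close> below half of a^2 + b^2. It rests on \<open>X\<close>
    exceeding the absolute value of \<open>c\<close>.\<close>
  have cross: "\<bar>2 * c * (a x * b x)\<bar> \<le> x * ((a x)\<^sup>2 + (b x)\<^sup>2)" if "x \<ge> X" for x
  proof -
    have "\<bar>2 * (a x * b x)\<bar> \<le> (a x)\<^sup>2 + (b x)\<^sup>2"
      using sum_squares_bound[of "\<bar>a x\<bar>" "\<bar>b x\<bar>"] by (simp add: abs_mult)
    then have "\<bar>c\<bar> * \<bar>2 * (a x * b x)\<bar> \<le> x * ((a x)\<^sup>2 + (b x)\<^sup>2)"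
      using that by (intro mult_mono) (auto simp: X_def)
    then show ?thesis by (simp add: abs_mult mult_ac)
  qed
  have dE: "(E has_field_derivative (2 * c * (a x * b x) - x * ((a x)\<^sup>2 + (b x)\<^sup>2)) / x\<^sup>2) (at x)" if "x > 0" for x
  proof -
    note d = assms[unfolded bessel_pair_def, rule_format, OF that]
    have "(E has_field_derivative
        2 * a x * (\<mu> / x * a x - b x) + 2 * b x * (a x - (\<mu> + 1) / x * b x)
        - (c * ((\<mu> / x * a x - b x) * b x + (a x - (\<mu> + 1) / x * b x) * a x) * x - c * (a x * b x) * 1) / (x * x)) (at x)"
      unfolding E_def[abs_def] power2_eq_square
      using that d
      by (intro DERIV_diff DERIV_divide DERIV_cmult DERIV_mult DERIV_ident)
         (auto intro!: DERIV_cong[OF DERIV_add[OF DERIV_mult DERIV_mult]])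
    moreover have "2 * a x * (\<mu> / x * a x - b x) + 2 * b x * (a x - (\<mu> + 1) / x * b x)
        - (c * ((\<mu> / x * a x - b x) * b x + (a x - (\<mu> + 1) / x * b x) * a x) * x - c * (a x * b x) * 1) / (x * x)
        = (2 * c * (a x * b x) - x * ((a x)\<^sup>2 + (b x)\<^sup>2)) / x\<^sup>2"
      using that unfolding c_def by (simp add: field_simps power2_eq_square)
    ultimately show ?thesis by simp
  qed
  have dec: "E x \<le> E X" if "x \<ge> X" for x
  proof (rule DERIV_nonpos_imp_nonincreasing[OF that])
    fix y assume y: "X \<le> y" "y \<le> x"
    then have "(2 * c * (a y * b y) - y * ((a y)\<^sup>2 + (b y)\<^sup>2)) / y\<^sup>2 \<le> 0"
      using cross[OF y(1)] by (intro divide_nonpos_nonneg) auto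
    then show "\<exists>z. (E has_field_derivative z) (at y) \<and> z \<le> 0"
      using dE[of y] y X by (intro exI conjI) auto
  qed
  have bound: "(a x)\<^sup>2 + (b x)\<^sup>2 \<le> 2 * E X" if "x \<ge> X" for x
  proof -
    have "c * (a x * b x) / x \<le> ((a x)\<^sup>2 + (b x)\<^sup>2) / 2"
      using cross[OF that] that X by (simp add: field_simps abs_le_iff)
    then have "(a x)\<^sup>2 + (b x)\<^sup>2 \<le> 2 * E x" unfolding E_def by argo
    with dec[OF that] show ?thesis by argo
  qed
  have "\<bar>a x\<bar> \<le> 2 * E X + 1 \<and> \<bar>b x\<bar> \<le> 2 * E X + 1" if "x \<ge> X" for x
  proof -
    \<comment> \<open>Comes from (|u| - 1)^2 >= 0 and turns a bound on squares into one on absolute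
      values without a root.\<close>
    have le: "\<bar>u\<bar> \<le> u\<^sup>2 + 1" for u :: real
      using zero_le_power2[of "\<bar>u\<bar> - 1"] abs_ge_zero[of u]
      unfolding power2_diff power2_abs by simp
    show ?thesis
      using bound[OF that] le[of "a x"] le[of "b x"] zero_le_power2[of "a x"] zero_le_power2[of "b x"]
      by linarith
  qed
  then show ?thesis by blast
qed

section \<open>Improper integral, decay and square integrability\<close>

text \<open>The fundamental theorem of calculus on [r0, R], which differs from the half-open
  interval by a null set, makes the truncated integral equal to \<open>F R\<close>.\<close>

lemma W_vanishes:
  assumes F: "\<And>s. s \<ge> r0 \<Longrightarrow> (F has_field_derivative W_integrand r0 k l f lam s) (at s)"
    and cont: "continuous_on {r0..} (W_integrand r0 k l f lam)"
    and F0: "F r0 = 0" and lim: "(F \<longlongrightarrow> 0) at_top"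
  shows "W_converges r0 k l f lam \<and> W r0 k l f lam = 0"
proof -
  let ?g = "W_integrand r0 k l f lam"
  have int: "set_integrable lebesgue {r0<..R} ?g" for R
    by (rule set_integrable_subset[OF absolutely_integrable_continuous_real[of r0 R]])
       (auto intro: continuous_on_subset[OF cont])
  have eq: "(LINT s:{r0<..R}|lebesgue. ?g s) = F R" if "R \<ge> r0" for R
  proof -
    have "(LINT s:{r0<..R}|lebesgue. ?g s) = integral {r0<..R} ?g"
      by (rule set_lebesgue_integral_eq_integral(2)[OF int])
    also have "\<dots> = integral {r0..R} ?g"
      by (rule integral_subset_negligible) (auto intro: negligible_subset[of "{r0}"])
    also have "\<dots> = F R - F r0"
      by (intro integral_unique fundamental_theorem_of_calculus that)
         (auto simp: has_real_derivative_iff_has_vector_derivative[symmetric]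
               intro!: has_field_derivative_at_within F)
    finally show ?thesis using F0 by simp
  qed
  have "((\<lambda>R. LINT s:{r0<..R}|lebesgue. ?g s) \<longlongrightarrow> 0) at_top"
    by (rule Lim_transform_eventually[OF lim])
       (use eq in \<open>auto intro: eventually_mono[OF eventually_ge_at_top[of r0]]\<close>)
  then show ?thesis
    unfolding W_converges_def W_def using int by (auto intro: tendsto_Lim)
qed

lemma powr_times_bounded_tendsto_0:
  fixes v :: "real \<Rightarrow> real"
  assumes "e < 0" "lam > 0" "\<forall>x\<ge>X. \<bar>v x\<bar> \<le> M"
  shows "((\<lambda>s. s powr e * v (lam * s)) \<longlongrightarrow> 0) at_top"
proof (rule Lim_null_comparison)
  show "((\<lambda>s. s powr e * M) \<longlongrightarrow> 0) at_top"
    using tendsto_mult_left_zero[OF tendsto_neg_powr[OF assms(1) filterlim_ident]] .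
  show "eventually (\<lambda>s. norm (s powr e * v (lam * s)) \<le> s powr e * M) at_top"
    using eventually_ge_at_top[of "X / lam"]
  proof eventually_elim
    case (elim s)
    then have "lam * s \<ge> X" using assms(2) by (simp add: field_simps)
    then show ?case using assms(3) by (simp add: abs_mult mult_left_mono)
  qed
qed

text \<open>After squaring and weighting the exponent is 2e + 1, and this is below -1 exactly when e
  < -1. The thresholds k > 1 (e = -k) and k < -1 (e = k) match this.\<close>

lemma powr_in_L2_weighted:
  assumes r0: "r0 > 0" and e: "e < -1"
  shows "(\<lambda>r. r powr e) \<in> L2_weighted r0"
proof -
  have "(\<lambda>r. r powr (2 * e + 1)) integrable_on {r0..}"
    using has_integral_powr_to_inf[of "2 * e + 1" r0] r0 e by (auto simp: integrable_on_def)
  then have "set_integrable lebesgue {r0..} (\<lambda>r. r powr (2 * e + 1))"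
    by (rule nonnegative_absolutely_integrable_1) simp
  then have "set_integrable lebesgue {r0<..} (\<lambda>r. r powr (2 * e + 1))"
    by (rule set_integrable_subset) auto
  moreover have "(r powr e)\<^sup>2 * r = r powr (2 * e + 1)" if "r > r0" for r
    using r0 that by (simp add: powr_add power2_eq_square powr_add[symmetric])
  ultimately have "set_integrable lebesgue {r0<..} (\<lambda>r. (r powr e)\<^sup>2 * r)"
    by (subst set_integrable_cong[OF refl refl]) auto
  moreover have "set_borel_measurable lebesgue {r0<..} (\<lambda>r. r powr e)"
    unfolding set_borel_measurable_def by (intro measurable_completion) measurable
  ultimately show ?thesis by (simp add: L2_weighted_def)
qed

lemma cross_product_pair:
  "bessel_pair \<mu> (\<lambda>z. bessel_J \<mu> z * p - bessel_Y \<mu> z * q)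
      (\<lambda>z. bessel_J (\<mu> + 1) z * p - bessel_Y (\<mu> + 1) z * q)"
  by (intro bessel_pair_combination bessel_pair_J bessel_pair_Y)

lemma continuous_on_bessel:
  "continuous_on {0<..} (bessel_J k)" "continuous_on {0<..} (bessel_Y k)"
  by (auto intro!: continuous_at_imp_continuous_on DERIV_isCont bessel_J_deriv_up bessel_Y_deriv_up)

lemma continuous_on_W_integrand:
  assumes "r0 > 0" "lam > 0" "continuous_on {r0..} f"
  shows "continuous_on {r0..} (W_integrand r0 k l f lam)"
proof -
  have "continuous_on {r0..} (\<lambda>s. bessel_J k (lam * s))" "continuous_on {r0..} (\<lambda>s. bessel_Y k (lam * s))"
    using assms by (auto intro!: continuous_on_compose2[OF continuous_on_bessel(1)]
        continuous_on_compose2[OF continuous_on_bessel(2)] continuous_intros)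
  then show ?thesis
    unfolding W_integrand_def divide_inverse using assms(3)
    by (intro continuous_intros)
qed

section \<open>The antiderivatives for the two kernel functions\<close>

lemma W_lower_order_kernel:
  assumes r0: "r0 > 0" and lam: "lam > 0" and k: "k > 1"
  shows "W_converges r0 k (k - 1) (\<lambda>r. 1 / r powr k) lam \<and> W r0 k (k - 1) (\<lambda>r. 1 / r powr k) lam = 0"
proof -
  let ?p = "bessel_Y (k - 1) (lam * r0)" and ?q = "bessel_J (k - 1) (lam * r0)"
  define d where "d = sqrt (?q\<^sup>2 + ?p\<^sup>2)"
  define u where "u z = bessel_J k z * ?p - bessel_Y k z * ?q" for z
  define v where "v z = bessel_J (k - 1) z * ?p - bessel_Y (k - 1) z * ?q" for z
  \<comment> \<open>From (z^(-l) C_l)' = - z^(-l) C_(l+1) with l = k - 1; the factor 1 /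
    \<open>lam\<close> undoes the chain rule and \<open>d\<close> is the normalisation of the
    transform.\<close>
  define F where "F s = - 1 / (lam * d) * (s powr (1 - k) * v (lam * s))" for s
  have pair: "bessel_pair (k - 1) v u"
    using cross_product_pair[of "k - 1" ?p ?q] by (simp add: u_def[abs_def] v_def[abs_def])
  show ?thesis
  proof (rule W_vanishes[where F = F])
    fix s assume "s \<ge> r0"
    with r0 have s: "s > 0" by simp
    have "((\<lambda>s. v (lam * s)) has_field_derivative
        ((k - 1) / (lam * s) * v (lam * s) - u (lam * s)) * lam) (at s)"
      using pair s lam unfolding bessel_pair_def
      by (intro DERIV_chain2[where f = v] DERIV_cmult_Id) simp
    moreover have "((\<lambda>s. s powr (1 - k)) has_field_derivative (1 - k) / s * s powr (1 - k)) (at s)"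
      using s by (intro DERIV_cong[OF has_real_derivative_powr[OF s]]) (simp add: powr_diff powr_minus_divide)
    ultimately have "(F has_field_derivative - 1 / (lam * d) *
        ((1 - k) / s * s powr (1 - k) * v (lam * s)
         + ((k - 1) / (lam * s) * v (lam * s) - u (lam * s)) * lam * s powr (1 - k))) (at s)"
      unfolding F_def[abs_def] by (intro DERIV_cmult DERIV_mult)
    \<comment> \<open>The terms in \<open>v\<close> cancel by the choice of exponent. If
      \<open>d = 0\<close>, both sides are 0 by the convention on division by zero.\<close>
    also have "- 1 / (lam * d) * ((1 - k) / s * s powr (1 - k) * v (lam * s)
         + ((k - 1) / (lam * s) * v (lam * s) - u (lam * s)) * lam * s powr (1 - k))
       = u (lam * s) / d * s powr (1 - k)"
      using s lam by (cases "d = 0") (simp_all add: field_simps)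
    also have "\<dots> = W_integrand r0 k (k - 1) (\<lambda>r. 1 / r powr k) lam s"
      using s by (simp add: W_integrand_def u_def d_def powr_diff)
    finally show "(F has_field_derivative W_integrand r0 k (k - 1) (\<lambda>r. 1 / r powr k) lam s) (at s)" .
  next
    show "continuous_on {r0..} (W_integrand r0 k (k - 1) (\<lambda>r. 1 / r powr k) lam)"
      using r0 lam by (intro continuous_on_W_integrand) (auto intro!: continuous_intros)
  next
    show "F r0 = 0" by (simp add: F_def v_def)
  next
    obtain M X where "\<forall>x\<ge>X. \<bar>v x\<bar> \<le> M" using bessel_pair_bounded[OF pair] by blast
    from powr_times_bounded_tendsto_0[OF _ lam this, of "1 - k"] k
    show "(F \<longlongrightarrow> 0) at_top"
      unfolding F_def[abs_def] by (intro tendsto_mult_right_zero) simp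
  qed
qed

lemma W_upper_order_kernel:
  assumes r0: "r0 > 0" and lam: "lam > 0" and k: "k < -1"
  shows "W_converges r0 k (k + 1) (\<lambda>r. r powr k) lam \<and> W r0 k (k + 1) (\<lambda>r. r powr k) lam = 0"
proof -
  let ?p = "bessel_Y (k + 1) (lam * r0)" and ?q = "bessel_J (k + 1) (lam * r0)"
  define d where "d = sqrt (?q\<^sup>2 + ?p\<^sup>2)"
  define u where "u z = bessel_J k z * ?p - bessel_Y k z * ?q" for z
  define v where "v z = bessel_J (k + 1) z * ?p - bessel_Y (k + 1) z * ?q" for z
  \<comment> \<open>Here \<open>v\<close> is the second component of the pair, so (z^l C_l)' = z^l
    C_(l-1) with l = k + 1 applies, and the sign is positive.\<close>
  define F where "F s = 1 / (lam * d) * (s powr (k + 1) * v (lam * s))" for s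
  have pair: "bessel_pair k u v"
    using cross_product_pair[of k ?p ?q] by (simp add: u_def[abs_def] v_def[abs_def])
  show ?thesis
  proof (rule W_vanishes[where F = F])
    fix s assume "s \<ge> r0"
    with r0 have s: "s > 0" by simp
    have "((\<lambda>s. v (lam * s)) has_field_derivative
        (u (lam * s) - (k + 1) / (lam * s) * v (lam * s)) * lam) (at s)"
      using pair s lam unfolding bessel_pair_def
      by (intro DERIV_chain2[where f = v] DERIV_cmult_Id) simp
    moreover have "((\<lambda>s. s powr (k + 1)) has_field_derivative (k + 1) / s * s powr (k + 1)) (at s)"
      using s by (intro DERIV_cong[OF has_real_derivative_powr[OF s]]) (simp add: powr_add)
    ultimately have "(F has_field_derivative 1 / (lam * d) *
        ((k + 1) / s * s powr (k + 1) * v (lam * s)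
         + (u (lam * s) - (k + 1) / (lam * s) * v (lam * s)) * lam * s powr (k + 1))) (at s)"
      unfolding F_def[abs_def] by (intro DERIV_cmult DERIV_mult)
    also have "1 / (lam * d) * ((k + 1) / s * s powr (k + 1) * v (lam * s)
         + (u (lam * s) - (k + 1) / (lam * s) * v (lam * s)) * lam * s powr (k + 1))
       = u (lam * s) / d * s powr (k + 1)"
      using s lam by (cases "d = 0") (simp_all add: field_simps)
    also have "\<dots> = W_integrand r0 k (k + 1) (\<lambda>r. r powr k) lam s"
      using s by (simp add: W_integrand_def u_def d_def powr_add)
    finally show "(F has_field_derivative W_integrand r0 k (k + 1) (\<lambda>r. r powr k) lam s) (at s)" .
  next
    show "continuous_on {r0..} (W_integrand r0 k (k + 1) (\<lambda>r. r powr k) lam)"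
      using r0 lam by (intro continuous_on_W_integrand) (auto intro!: continuous_intros)
  next
    show "F r0 = 0" by (simp add: F_def v_def)
  next
    obtain M X where "\<forall>x\<ge>X. \<bar>v x\<bar> \<le> M" using bessel_pair_bounded[OF pair] by blast
    from powr_times_bounded_tendsto_0[OF _ lam this, of "k + 1"] k
    show "(F \<longlongrightarrow> 0) at_top"
      unfolding F_def[abs_def] by (intro tendsto_mult_right_zero) simp
  qed
qed

theorem lemma3p1:
  fixes r0 :: real
  assumes "r0 > 0"
  shows "(\<forall>k::real. k > 1 \<longrightarrow>
            (\<lambda>r. 1 / r powr k) \<in> L2_weighted r0 \<and>
            (\<forall>lam>0. W_converges r0 k (k - 1) (\<lambda>r. 1 / r powr k) lam \<and>
                      W r0 k (k - 1) (\<lambda>r. 1 / r powr k) lam = 0)) \<and>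
         (\<forall>k::real. k < -1 \<longrightarrow>
            (\<lambda>r. r powr k) \<in> L2_weighted r0 \<and>
            (\<forall>lam>0. W_converges r0 k (k + 1) (\<lambda>r. r powr k) lam \<and>
                      W r0 k (k + 1) (\<lambda>r. r powr k) lam = 0))"
proof (intro conjI allI impI)
  fix k :: real assume "k > 1"
  then show "(\<lambda>r. 1 / r powr k) \<in> L2_weighted r0"
    using powr_in_L2_weighted[OF assms, of "- k"] by (simp add: powr_minus_divide)
qed (use assms W_lower_order_kernel W_upper_order_kernel powr_in_L2_weighted in blast)+

end
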